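(* There exist an irreducible incommensurable normalized multiscale substitution scheme $\sigma$ and a stationary tiling $\mathcal{S}=\bigcup_{k=0}^{\infty}F_{ks}(T)\in\mathbb{X}_\sigma^F$ such that its tile complexity function satisfies $c_{\mathcal{S}}(k+1)=c_{\mathcal{S}}(k)+1$ for all $k\in\mathbb{N}$.
   Context: Schemes. A tile in $\mathbb{R}^d$ is a bounded Lebesgue measurable set $T$ of positive measure $\mathrm{vol}\,T$ whose boundary has measure zero. A tessellation of $U\subset\mathbb{R}^d$ is a collection of tiles with pairwise disjoint interiors and union $U$; it is called a patch if $U$ is bounded ($U$ is then the support of the patch) and a tiling if $U=\mathbb{R}^d$. A multiscale substitution scheme $\sigma=(\tau_\sigma,\varrho_\sigma)$ consists of a finite list of prototiles $\tau_\sigma=(T_1,\dots,T_n)$ and, for each $i$, a tessellation $\varrho_\sigma(T_i)$ of $T_i$ all of whose tiles are translates of rescaled prototiles; the list of these rescaled prototiles is $\omega_\sigma(T_i)=(\alpha_{ij}^{(k)}T_j:\ j=1,\dots,n,\ k=1,\dots,k_{ij})$. Here $0<\alpha_{ij}^{(k)}<1$. A translate of $\alpha T_j$, $\alpha>0$, is a tile of type $j$ and scale $\alpha$. Standing assumptions: $\sigma$ is normalized, i.e. $\mathrm{vol}\,T_i=1$ for all $i$; distinct prototiles are geometrically different ($T_i$ is not a rescaled copy of $T_j$ for $i\ne j$), so the type of a tile is determined by the tile. Graph. The associated graph $G_\sigma$ is the directed weighted multigraph with vertices $1,\dots,n$ and, for each tile $\alpha T_j$ in the list $\omega_\sigma(T_i)$,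 an edge from $i$ to $j$ of length $\log\frac1\alpha$. Substitution semi-flow. For $t\ge 0$, $F_t(T_i)$ is the patch supported on $e^tT_i$ obtained by starting with $e^tT_i$ and repeatedly substituting (according to the rescaled rule $\varrho_\sigma$) every tile of volume $>1$, until all tiles have volume $\le 1$. In the same way $F_t$ is defined on every tile $T$ that is a translate of $\alpha T_i$ with $0<\alpha\le 1$ ($F_t(T)$ is supported on $e^tT$), on patches of such tiles, and on tilings by such tiles (tile by tile). $\sigma$ is irreducible if for all $i,j$ there is $t>0$ such that $F_t(T_i)$ contains a tile of type $j$. $\sigma$ is incommensurable if there are $i,j$ and $t_1,t_2>0$ with $t_1\notin\mathbb{Q}t_2$ such that $F_{t_1}(T_i)$ contains a tile of type $i$ and unit volume and $F_{t_2}(T_j)$ contains a tile of type $j$ and unit volume. Let $\mathscr{S}_{i\to i}$ be the set of $t$ such that $F_t(T_i)$ contains a tile of type $i$ and unit volume. Tiling space. Let $\mathscr{P}_\sigma=\{F_t(T_i): t\ge0,\ i=1,\dots,n\}$. Identify a patch or tiling with the closed set which is the union of the boundaries of its tiles. On closed subsets of $\mathbb{R}^d$ use the metric $D(A_1,A_2)=\inf(\{r>0: A_1\cap B(0,1/r)\subset A_2^{+r},\ A_2\cap B(0,1/r)\subset A_1^{+r}\}\cup\{1\})$, where $A^{+r}$ is the $r$-neighborhood of $A$ and $B(x,R)$ is the open Euclidean ball. $\mathbb{X}^F_\sigma$ is the set of all tilings $\mathcal{T}$ of $\mathbb{R}^d$ such that every sub-patch of $\mathcal{T}$ is a limit, with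 respect to $D$, of translated sub-patches of elements of $\mathscr{P}_\sigma$. A stationary tiling is a tiling $\mathcal{S}\in\mathbb{X}_\sigma^F$ of the form $\mathcal{S}=\bigcup_{k\ge0}F_{a+ks}(T_i)$ with $0<s\in\mathscr{S}_{i\to i}$, $a\ge0$, where $T_i$ is positioned so that the origin is an interior point and the patches $F_{a+ks}(T_i)$, $k\ge0$, are nested (each a sub-patch of the next). It satisfies $F_s(\mathcal{S})=\mathcal{S}$. It is assumed that $s$ is minimal in the sense that the closed path in $G_\sigma$ associated with it (recording the sequence of ancestors of the tile concerned) is not a concatenation of several copies of a single closed path. Every stationary tiling can be written as $\mathcal{S}=\bigcup_{k\ge0}F_{ks}(T)$ (nested union) with $T$ a single tile, a rescaled copy of a prototile. Tile complexity. For $k\ge0$, $c_{\mathcal{S}}(k)$ is the number of distinct tiles, up to translation, in the patch $F_{ks}(T)$. *)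

theory Defs
  imports "HOL-Analysis.Analysis" "Graph_Theory.Arc_Walk"
begin

section \<open>Tiles, tessellations and substitution schemes\<close>

text \<open>The ambient space is \<open>real ^ 'd\<close>, with \<open>'d\<close> an arbitrary finite index type.\<close>

definition tile :: "(real ^ 'd) set \<Rightarrow> bool" where
  "tile T \<longleftrightarrow> bounded T \<and> T \<in> sets lebesgue \<and> measure lebesgue T > 0
      \<and> frontier T \<in> null_sets lebesgue"

text \<open>A tile has non-empty interior, so tiles of a collection with pairwise disjoint interiors are
  pairwise distinct sets and nothing is lost by using sets of tiles instead of families.\<close>

definition tessellation :: "(real ^ 'd) set set \<Rightarrow> (real ^ 'd) set \<Rightarrow> bool" where
  "tessellation P U \<longleftrightarrow> (\<forall>S\<in>P. tile S)
      \<and> (\<forall>S\<in>P. \<forall>S'\<in>P. S \<noteq> S' \<longrightarrow> interior S \<inter> interior S' = {}) \<and> \<Union>P = U"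

definition patch :: "(real ^ 'd) set set \<Rightarrow> bool" where
  "patch P \<longleftrightarrow> (\<exists>U. bounded U \<and> tessellation P U)"

definition tiling :: "(real ^ 'd) set set \<Rightarrow> bool" where
  "tiling P \<longleftrightarrow> tessellation P UNIV"

definition affine_copy :: "real ^ 'd \<Rightarrow> real \<Rightarrow> (real ^ 'd) set \<Rightarrow> (real ^ 'd) set" where
  "affine_copy v \<alpha> A = (\<lambda>x. v + \<alpha> *\<^sub>R x) ` A"

text \<open>Prototiles are indexed from \<open>0\<close>. The rule assigns to \<open>i\<close> the tessellation of the \<open>i\<close>-th
  prototile; types and scales of its tiles are recovered from the tiles themselves.\<close>

record ('d::finite) scheme =
  protos :: "(real ^ 'd) set list"
  rule :: "nat \<Rightarrow> (real ^ 'd) set set"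

definition types :: "('d::finite) scheme \<Rightarrow> nat set" where
  "types \<sigma> = {..<length (protos \<sigma>)}"

definition proto :: "('d::finite) scheme \<Rightarrow> nat \<Rightarrow> (real ^ 'd) set" where
  "proto \<sigma> i = protos \<sigma> ! i"

definition tile_of :: "('d::finite) scheme \<Rightarrow> nat \<Rightarrow> real \<Rightarrow> (real ^ 'd) set \<Rightarrow> bool" where
  "tile_of \<sigma> j \<alpha> S \<longleftrightarrow> j \<in> types \<sigma> \<and> \<alpha> > 0 \<and> (\<exists>v. S = affine_copy v \<alpha> (proto \<sigma> j))"

definition multiscale_scheme :: "('d::finite) scheme \<Rightarrow> bool" where
  "multiscale_scheme \<sigma> \<longleftrightarrow> types \<sigma> \<noteq> {} \<and>
     (\<forall>i\<in>types \<sigma>. tile (proto \<sigma> i) \<and> finite (rule \<sigma> i) \<and> tessellation (rule \<sigma> i) (proto \<sigma> i)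
        \<and> (\<forall>S\<in>rule \<sigma> i. \<exists>j \<alpha>. \<alpha> < 1 \<and> tile_of \<sigma> j \<alpha> S))"

definition normalized :: "('d::finite) scheme \<Rightarrow> bool" where
  "normalized \<sigma> \<longleftrightarrow> (\<forall>i\<in>types \<sigma>. measure lebesgue (proto \<sigma> i) = 1)"

text \<open>Distinct prototiles do not differ by a rescaling and a translation only, so that the type of a
  tile is determined by the tile.\<close>

definition geometrically_distinct :: "('d::finite) scheme \<Rightarrow> bool" where
  "geometrically_distinct \<sigma> \<longleftrightarrow>
     (\<forall>i\<in>types \<sigma>. \<forall>j\<in>types \<sigma>. i \<noteq> j \<longrightarrow> \<not> (\<exists>\<alpha>. tile_of \<sigma> j \<alpha> (proto \<sigma> i)))"

definition tile_type :: "('d::finite) scheme \<Rightarrow> (real ^ 'd) set \<Rightarrow> nat" where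
  "tile_type \<sigma> S = (THE j. \<exists>\<alpha>. tile_of \<sigma> j \<alpha> S)"

definition tile_scale :: "('d::finite) scheme \<Rightarrow> (real ^ 'd) set \<Rightarrow> real" where
  "tile_scale \<sigma> S = (THE \<alpha>. \<exists>j. tile_of \<sigma> j \<alpha> S)"


section \<open>The associated graph\<close>

text \<open>The edge given by a tile \<open>R\<close> of the tessellation of the \<open>i\<close>-th prototile is \<open>(i, R)\<close>.\<close>

definition scheme_graph :: "('d::finite) scheme \<Rightarrow> (nat, nat \<times> (real ^ 'd) set) pre_digraph" where
  "scheme_graph \<sigma> = \<lparr> verts = types \<sigma>, arcs = {(i, R). i \<in> types \<sigma> \<and> R \<in> rule \<sigma> i},
     tail = fst, head = (\<lambda>e. tile_type \<sigma> (snd e)) \<rparr>"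

definition edge_length :: "('d::finite) scheme \<Rightarrow> nat \<times> (real ^ 'd) set \<Rightarrow> real" where
  "edge_length \<sigma> e = ln (1 / tile_scale \<sigma> (snd e))"


section \<open>The substitution semi-flow\<close>

text \<open>The representation of a tile as \<open>affine_copy v \<alpha> (proto \<sigma> i)\<close> is unique (\<open>\<alpha>\<close> by
  volume, \<open>i\<close> by geometric distinctness, \<open>v\<close> by boundedness), so the following is the rescaled
  rule applied to a single tile.\<close>

definition subst_tile :: "('d::finite) scheme \<Rightarrow> (real ^ 'd) set \<Rightarrow> (real ^ 'd) set set" where
  "subst_tile \<sigma> S = {affine_copy v \<alpha> R | v \<alpha> i R.
     i \<in> types \<sigma> \<and> \<alpha> > 0 \<and> S = affine_copy v \<alpha> (proto \<sigma> i) \<and> R \<in> rule \<sigma> i}"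

definition subst_large :: "('d::finite) scheme \<Rightarrow> (real ^ 'd) set set \<Rightarrow> (real ^ 'd) set set" where
  "subst_large \<sigma> P = (\<Union>S\<in>P. if measure lebesgue S > 1 then subst_tile \<sigma> S else {S})"

text \<open>\<open>flow \<sigma> t T\<close> is \<open>F\<^sub>t(T)\<close> for \<open>t \<ge> 0\<close> and a single tile \<open>T\<close> of scale at most \<open>1\<close>. Since
  \<open>subst_large\<close> fixes patches whose tiles all have volume at most \<open>1\<close>, the choice of the least number
  of iterations is immaterial; such a number exists because the finitely many scales in the rule are
  less than \<open>1\<close>.\<close>

definition flow :: "('d::finite) scheme \<Rightarrow> real \<Rightarrow> (real ^ 'd) set \<Rightarrow> (real ^ 'd) set set" where
  "flow \<sigma> t T = (let P = (\<lambda>m. (subst_large \<sigma> ^^ m) {affine_copy 0 (exp t) T})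
     in P (LEAST m. \<forall>S\<in>P m. measure lebesgue S \<le> 1))"

definition irreducible_scheme :: "('d::finite) scheme \<Rightarrow> bool" where
  "irreducible_scheme \<sigma> \<longleftrightarrow> (\<forall>i\<in>types \<sigma>. \<forall>j\<in>types \<sigma>. \<exists>t>0.
     \<exists>S\<in>flow \<sigma> t (proto \<sigma> i). \<exists>\<alpha>. tile_of \<sigma> j \<alpha> S)"

definition return_times :: "('d::finite) scheme \<Rightarrow> nat \<Rightarrow> real set" where
  "return_times \<sigma> i = {t. t \<ge> 0 \<and> (\<exists>S\<in>flow \<sigma> t (proto \<sigma> i).
     (\<exists>\<alpha>. tile_of \<sigma> i \<alpha> S) \<and> measure lebesgue S = 1)}"

definition incommensurable :: "('d::finite) scheme \<Rightarrow> bool" where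
  "incommensurable \<sigma> \<longleftrightarrow> (\<exists>i\<in>types \<sigma>. \<exists>j\<in>types \<sigma>. \<exists>t1\<in>return_times \<sigma> i. \<exists>t2\<in>return_times \<sigma> j.
     t1 > 0 \<and> t2 > 0 \<and> \<not> (\<exists>q\<in>\<rat>. t1 = q * t2))"


section \<open>The tiling space\<close>

definition nbhd :: "real \<Rightarrow> (real ^ 'd) set \<Rightarrow> (real ^ 'd) set" where
  "nbhd r A = (\<Union>a\<in>A. ball a r)"

definition set_dist :: "(real ^ 'd) set \<Rightarrow> (real ^ 'd) set \<Rightarrow> real" where
  "set_dist A B = Inf ({r. r > 0 \<and> A \<inter> ball 0 (1 / r) \<subseteq> nbhd r B \<and> B \<inter> ball 0 (1 / r) \<subseteq> nbhd r A} \<union> {1})"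

definition skeleton :: "(real ^ 'd) set set \<Rightarrow> (real ^ 'd) set" where
  "skeleton P = (\<Union>S\<in>P. frontier S)"

definition generating_patches :: "('d::finite) scheme \<Rightarrow> (real ^ 'd) set set set" where
  "generating_patches \<sigma> = {flow \<sigma> t (proto \<sigma> i) | t i. t \<ge> 0 \<and> i \<in> types \<sigma>}"

definition tiling_space :: "('d::finite) scheme \<Rightarrow> (real ^ 'd) set set set" where
  "tiling_space \<sigma> = {\<T>. tiling \<T> \<and> (\<forall>P. P \<subseteq> \<T> \<and> patch P \<longrightarrow>
     (\<exists>Q. (\<forall>m::nat. \<exists>G\<in>generating_patches \<sigma>. \<exists>G'\<subseteq>G. \<exists>v. Q m = affine_copy v 1 ` G')
        \<and> (\<lambda>m. set_dist (skeleton (Q m)) (skeleton P)) \<longlonglongrightarrow> 0))}"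


section \<open>Stationary tilings and tile complexity\<close>

text \<open>\<open>ancestry \<sigma> S p S'\<close>: repeated substitution of tiles of volume greater than \<open>1\<close>, starting with
  the tile \<open>S\<close>, leads to the tile \<open>S'\<close>, and \<open>p\<close> is the list of edges corresponding to the
  successive steps from \<open>S\<close> down to \<open>S'\<close>.\<close>

inductive ancestry :: "('d::finite) scheme \<Rightarrow> (real ^ 'd) set \<Rightarrow> (nat \<times> (real ^ 'd) set) list
    \<Rightarrow> (real ^ 'd) set \<Rightarrow> bool" for \<sigma> where
  ancestry_Nil: "ancestry \<sigma> S [] S"
| ancestry_Cons: "\<lbrakk> i \<in> types \<sigma>; \<alpha> > 0; S = affine_copy v \<alpha> (proto \<sigma> i); measure lebesgue S > 1;
     R \<in> rule \<sigma> i; ancestry \<sigma> (affine_copy v \<alpha> R) p S' \<rbrakk> \<Longrightarrow> ancestry \<sigma> S ((i, R) # p) S'"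

definition closed_path :: "('d::finite) scheme \<Rightarrow> (nat \<times> (real ^ 'd) set) list \<Rightarrow> bool" where
  "closed_path \<sigma> p \<longleftrightarrow> p \<noteq> [] \<and> (\<exists>i. pre_digraph.awalk (scheme_graph \<sigma>) i p i)"

definition primitive_closed_path ::
    "('d::finite) scheme \<Rightarrow> (nat \<times> (real ^ 'd) set) list \<Rightarrow> bool" where
  "primitive_closed_path \<sigma> p \<longleftrightarrow> closed_path \<sigma> p
     \<and> \<not> (\<exists>q m. m \<ge> 2 \<and> closed_path \<sigma> q \<and> p = concat (replicate m q))"

text \<open>Here \<open>U\<close> is the \<open>i\<close>-th prototile in the position which makes the patches nested. The tile whose
  ancestors give the closed path of \<open>s\<close> is \<open>U\<close> itself, as a unit tile of type \<open>i\<close> in \<open>F\<^sub>s(U)\<close>.\<close>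

definition stationary_tiling ::
    "('d::finite) scheme \<Rightarrow> real \<Rightarrow> (real ^ 'd) set set \<Rightarrow> bool" where
  "stationary_tiling \<sigma> s \<S> \<longleftrightarrow> \<S> \<in> tiling_space \<sigma> \<and>
     (\<exists>i\<in>types \<sigma>. \<exists>a\<ge>0. \<exists>v U. 0 < s \<and> s \<in> return_times \<sigma> i
        \<and> U = affine_copy v 1 (proto \<sigma> i) \<and> 0 \<in> interior U
        \<and> (\<forall>k. flow \<sigma> (a + real k * s) U \<subseteq> flow \<sigma> (a + real (Suc k) * s) U)
        \<and> \<S> = (\<Union>k. flow \<sigma> (a + real k * s) U)
        \<and> U \<in> flow \<sigma> s U
        \<and> (\<exists>p. ancestry \<sigma> (affine_copy 0 (exp s) U) p U
             \<and> sum_list (map (edge_length \<sigma>) p) = s \<and> primitive_closed_path \<sigma> p))"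

text \<open>The nested presentation of \<open>\<S>\<close> with respect to which tile complexity is defined.\<close>

definition presented_by ::
    "('d::finite) scheme \<Rightarrow> real \<Rightarrow> (real ^ 'd) set \<Rightarrow> (real ^ 'd) set set \<Rightarrow> bool" where
  "presented_by \<sigma> s T \<S> \<longleftrightarrow> (\<exists>j \<alpha>. \<alpha> \<le> 1 \<and> tile_of \<sigma> j \<alpha> T)
     \<and> (\<forall>k. flow \<sigma> (real k * s) T \<subseteq> flow \<sigma> (real (Suc k) * s) T)
     \<and> \<S> = (\<Union>k. flow \<sigma> (real k * s) T)"

definition translation_rel :: "((real ^ 'd) set \<times> (real ^ 'd) set) set" where
  "translation_rel = {(A, B). \<exists>v. B = affine_copy v 1 A}"

definition tile_complexity ::
    "('d::finite) scheme \<Rightarrow> real \<Rightarrow> (real ^ 'd) set \<Rightarrow> nat \<Rightarrow> nat" where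
  "tile_complexity \<sigma> s T k = card (flow \<sigma> (real k * s) T // translation_rel)"

end

theory Submission
  imports Defs
begin

text \<open>A scheme with a single prototile suffices in every dimension \<open>d\<close>. The prototile is the unit
  cube centred at the origin. Cut it into a grid of \<open>5 ^ d\<close> cubes of side \<open>1/5\<close> and merge the inner
  \<open>3 ^ d\<close> of them into one cube of side \<open>3/5\<close>: the rule consists of the central cube of scale \<open>3/5\<close>
  and of the outer layer of cubes of scale \<open>1/5\<close>. The two scales satisfy no multiplicative relation,
  since \<open>5 ^ b = 3 ^ b * 5 ^ a\<close> forces \<open>b = 0\<close>; this is the incommensurability.

  The central cube has the same centre as the prototile, so inflating by \<open>5/3\<close> and substituting
  brings back the prototile in place: with \<open>s = ln (5/3)\<close> the patches at times \<open>k * s\<close> are nested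
  (lemma \<open>supertile_mono_Suc\<close>), and they fill the cubes of side \<open>(5/3) ^ k\<close> around the origin,
  hence their union is a tiling. Every bounded part of this tiling lies in one of the patches
  (lemma \<open>subpatch_in_supertile\<close>), so it belongs to the tiling space with constant approximating
  sequences. The closed path of \<open>s\<close> is the single loop given by the central cube, so it is primitive.

  All tiles are cubes, so tiles up to translation are the same as scales. A cube met on the way from
  \<open>(5/3) ^ k\<close> down has side \<open>(5/3) ^ j / 5 ^ i\<close> with \<open>j \<le> k\<close>: passing to the central cube lowers \<open>j\<close>
  by one, passing to an outer cube raises \<open>i\<close> by one. For each \<open>j\<close> the substitution can stop at
  only one \<open>i\<close>, the least one with \<open>(5/3) ^ j / 5 ^ i \<le> 1\<close>. Indeed, the parent of a final cube has
  side larger than \<open>1\<close>. If the final cube is an outer one, this side is \<open>(5/3) ^ j / 5 ^ (i - 1)\<close>;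
  if it is a central one, this side is \<open>(5/3) ^ (j + 1) / 5 ^ i\<close>, a third of
  \<open>(5/3) ^ j / 5 ^ (i - 1)\<close>. In both cases \<open>i - 1\<close> is too small an exponent
  (lemma \<open>supertile_scales_subset\<close>). The values \<open>j = 0, ..., k\<close> all occur and give
  distinct scales, so the complexity is \<open>k + 1\<close>.\<close>

section \<open>Tessellations\<close>

lemma tessellation_disjoint_interiors:
  "tessellation P U \<Longrightarrow> S \<in> P \<Longrightarrow> S' \<in> P \<Longrightarrow> S \<noteq> S' \<Longrightarrow> interior S \<inter> interior S' = {}"
  by (simp add: tessellation_def)

lemma tessellation_refine:
  assumes P: "tessellation P U" and f: "\<And>S. S \<in> P \<Longrightarrow> tessellation (f S) S"
  shows "tessellation (\<Union>S\<in>P. f S) U"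
proof -
  have sub: "A \<subseteq> S" if "S \<in> P" "A \<in> f S" for A S
    using f[OF that(1)] that unfolding tessellation_def by blast
  have disj: "interior A \<inter> interior B = {}"
    if S: "S \<in> P" "A \<in> f S" and S': "S' \<in> P" "B \<in> f S'" and "A \<noteq> B" for A B S S'
  proof (cases "S = S'")
    case True
    then show ?thesis using f[OF S(1)] S S' \<open>A \<noteq> B\<close> unfolding tessellation_def by blast
  next
    case False
    then have "interior S \<inter> interior S' = {}"
      using P S S' unfolding tessellation_def by blast
    moreover have "interior A \<subseteq> interior S" "interior B \<subseteq> interior S'"
      using sub S S' by (simp_all add: interior_mono)
    ultimately show ?thesis by blast
  qed
  have "(\<Union>S\<in>P. \<Union>(f S)) = \<Union>P"
    using f unfolding tessellation_def by auto
  moreover have "\<forall>A\<in>(\<Union>S\<in>P. f S). tile A"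
    using f unfolding tessellation_def by blast
  ultimately show ?thesis
    using P disj unfolding tessellation_def by auto
qed

lemma tessellation_nested_Union:
  fixes P :: "nat \<Rightarrow> (real ^ 'd) set set"
  assumes t: "\<And>k. tessellation (P k) (U k)" and m: "\<And>k. P k \<subseteq> P (Suc k)"
  shows "tessellation (\<Union>k. P k) (\<Union>k. U k)"
proof -
  have mono: "P i \<subseteq> P j" if "i \<le> j" for i j
    using that by (rule lift_Suc_mono_le[of P, OF m])
  have disj: "interior A \<inter> interior B = {}" if "A \<in> P i" "B \<in> P j" "A \<noteq> B" for A B i j
  proof -
    have "A \<in> P (max i j)" "B \<in> P (max i j)"
      using that mono[of i "max i j"] mono[of j "max i j"] by auto
    then show ?thesis using t[of "max i j"] that(3) unfolding tessellation_def by blast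
  qed
  have U: "U k = \<Union>(P k)" for k
    using t unfolding tessellation_def by simp
  have "\<Union>(\<Union>k. P k) = (\<Union>k. U k)"
    unfolding U by blast
  moreover have "\<forall>S\<in>(\<Union>k. P k). tile S"
    using t unfolding tessellation_def by simp
  ultimately show ?thesis
    unfolding tessellation_def using disj by (metis UN_E)
qed

text \<open>The nonempty open interior of a tile \<open>S\<close> of \<open>P'\<close> inside the support of \<open>P\<close> has to meet a tile
  of \<open>P\<close>, hence, as the tiles of \<open>P\<close> are the closures of their interiors, the interior of such a
  tile; disjointness of interiors within \<open>P'\<close> forces \<open>S\<close> to be that tile.\<close>

lemma tile_within_support_mem:
  assumes P': "tessellation P' U'" and P: "tessellation P U" and "P \<subseteq> P'"
    and cl: "\<And>S. S \<in> P \<Longrightarrow> S \<subseteq> closure (interior S)"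
    and S: "S \<in> P'" "S \<subseteq> U" "interior S \<noteq> {}"
  shows "S \<in> P"
proof (rule ccontr)
  assume "S \<notin> P"
  have *: "interior S \<inter> A = {}" if "A \<in> P" for A
  proof -
    have "interior S \<inter> interior A = {}"
    proof -
      have "A \<in> P'" "S \<noteq> A" using that \<open>S \<notin> P\<close> \<open>P \<subseteq> P'\<close> by auto
      then show ?thesis using S(1) P' unfolding tessellation_def by simp
    qed
    then have "interior S \<inter> closure (interior A) = {}"
      by (simp add: open_Int_closure_eq_empty)
    then show ?thesis using cl[OF that] by blast
  qed
  have "\<Union>P = U" using P unfolding tessellation_def by simp
  then have "interior S \<inter> U = {}" using * by blast
  then show False using S interior_subset by blast
qed

text \<open>Every positive radius is admissible when a set is compared with itself.\<close>

lemma set_dist_self: "set_dist A A = 0"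
proof -
  have *: "{r. r > 0 \<and> A \<inter> ball 0 (1 / r) \<subseteq> nbhd r A \<and> A \<inter> ball 0 (1 / r) \<subseteq> nbhd r A} \<union> {1}
      = {0::real<..}"
    by (force simp: nbhd_def)
  have "Inf {0::real<..} = 0" by simp
  then show ?thesis unfolding set_dist_def * .
qed

section \<open>Iterated substitution\<close>

lemma affine_copy_id [simp]: "affine_copy 0 1 A = A"
  by (simp add: affine_copy_def)

lemma funpow_subst_large_mono:
  "P \<subseteq> P' \<Longrightarrow> (subst_large \<sigma> ^^ m) P \<subseteq> (subst_large \<sigma> ^^ m) P'"
proof (induction m arbitrary: P P')
  case (Suc m)
  have "subst_large \<sigma> P \<subseteq> subst_large \<sigma> P'"
    using Suc.prems unfolding subst_large_def by blast
  then show ?case using Suc.IH by (simp add: funpow_swap1)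
qed simp

lemma subst_large_memI:
  "S \<in> subst_tile \<sigma> R \<Longrightarrow> R \<in> P \<Longrightarrow> measure lebesgue R > 1 \<Longrightarrow> S \<in> subst_large \<sigma> P"
  by (auto simp: subst_large_def)

lemma subst_large_fixes_small:
  "\<forall>S\<in>P. measure lebesgue S \<le> 1 \<Longrightarrow> subst_large \<sigma> P = P"
  by (force simp: subst_large_def)

lemma funpow_subst_large_stable:
  assumes "\<forall>S\<in>(subst_large \<sigma> ^^ m) P. measure lebesgue S \<le> 1" "m \<le> n"
  shows "(subst_large \<sigma> ^^ n) P = (subst_large \<sigma> ^^ m) P"
  using \<open>m \<le> n\<close> by (induction n rule: dec_induct) (use assms(1) in \<open>simp_all add: subst_large_fixes_small\<close>)

text \<open>This allows a tile to be located in \<open>flow\<close> by exhibiting it at any finite stage, without knowing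
  at which stage the substitution ends.\<close>

lemma small_tile_persists:
  assumes "S \<in> (subst_large \<sigma> ^^ m) P" "measure lebesgue S \<le> 1" "m \<le> n"
  shows "S \<in> (subst_large \<sigma> ^^ n) P"
  using \<open>m \<le> n\<close>
proof (induction n rule: dec_induct)
  case (step n)
  then show ?case using assms(2) by (force simp: subst_large_def)
qed (use assms in simp)

lemma flow_eq_funpow:
  assumes "\<forall>S\<in>(subst_large \<sigma> ^^ m) {affine_copy 0 (exp t) T}. measure lebesgue S \<le> 1"
  shows "flow \<sigma> t T = (subst_large \<sigma> ^^ m) {affine_copy 0 (exp t) T}"
proof -
  let ?small = "\<lambda>m. \<forall>S\<in>(subst_large \<sigma> ^^ m) {affine_copy 0 (exp t) T}. measure lebesgue S \<le> 1"
  have "?small (LEAST m. ?small m)" "(LEAST m. ?small m) \<le> m"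
    using assms by (rule LeastI, rule Least_le)
  then show ?thesis
    unfolding flow_def Let_def by (rule funpow_subst_large_stable[symmetric])
qed

section \<open>Cubes\<close>

definition cube :: "real ^ 'd \<Rightarrow> real \<Rightarrow> (real ^ 'd) set" where
  "cube c a = {x. \<forall>i. \<bar>x $ i - c $ i\<bar> \<le> a / 2}"

lemma cube_eq_cbox: "cube c a = cbox (\<chi> i. c $ i - a / 2) (\<chi> i. c $ i + a / 2)"
proof -
  have "\<bar>u - v\<bar> \<le> a / 2 \<longleftrightarrow> v - a / 2 \<le> u \<and> u \<le> v + a / 2" for u v by argo
  then show ?thesis by (simp add: cube_def set_eq_iff mem_box_cart)
qed

lemma interior_cube: "interior (cube c a) = {x. \<forall>i. \<bar>x $ i - c $ i\<bar> < a / 2}"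
proof -
  have "\<bar>u - v\<bar> < a / 2 \<longleftrightarrow> v - a / 2 < u \<and> u < v + a / 2" for u v by argo
  then show ?thesis by (simp add: cube_eq_cbox set_eq_iff mem_box_cart)
qed

lemma measure_cube:
  fixes c :: "real ^ 'd"
  assumes "a > 0"
  shows "measure lebesgue (cube c a) = a ^ CARD('d)"
proof -
  have "c \<in> cbox (\<chi> i. c $ i - a / 2) (\<chi> i. c $ i + a / 2)"
    using assms by (simp add: mem_box_cart)
  then have "cbox (\<chi> i. c $ i - a / 2) (\<chi> i. c $ i + a / 2) \<noteq> {}" by blast
  then show ?thesis
    unfolding cube_eq_cbox by (simp add: content_cbox_cart)
qed

lemma measure_cube_gt_1_iff: "a > 0 \<Longrightarrow> measure lebesgue (cube c a) > 1 \<longleftrightarrow> a > 1"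
  by (metis measure_cube one_less_power power_le_one less_imp_le not_less zero_less_card_finite)

lemma measure_cube_le_1_iff: "a > 0 \<Longrightarrow> measure lebesgue (cube c a) \<le> 1 \<longleftrightarrow> a \<le> 1"
  using measure_cube_gt_1_iff not_less by metis

lemma tile_cube: "a > 0 \<Longrightarrow> tile (cube c a)"
  unfolding tile_def using measure_cube[of a c] negligible_convex_frontier[of "cube c a"]
  by (auto simp: cube_eq_cbox negligible_iff_null_sets)

lemma interior_cube_nonempty: "a > 0 \<Longrightarrow> interior (cube c a) \<noteq> {}"
  using interior_cube[of c a] by (auto intro!: exI[of _ c])

lemma cube_subset_closure_interior: "a > 0 \<Longrightarrow> cube c a \<subseteq> closure (interior (cube c a))"
  using interior_cube_nonempty[of a c] closure_subset
  by (simp add: convex_closure_interior cube_eq_cbox)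

text \<open>Scaled translates of cubes are again cubes, so every iterate of the substitution can be described
  by centres and sides alone.\<close>

lemma affine_copy_cube:
  assumes "b > 0"
  shows "affine_copy v b (cube c a) = cube (v + b *\<^sub>R c) (b * a)"
proof -
  have scale: "\<bar>b * y - b * z\<bar> \<le> b * a / 2 \<longleftrightarrow> \<bar>y - z\<bar> \<le> a / 2" for y z
  proof -
    have "\<bar>b * y - b * z\<bar> = b * \<bar>y - z\<bar>"
      using assms by (simp add: right_diff_distrib[symmetric] abs_mult)
    then show ?thesis using assms by simp
  qed
  have "y \<in> affine_copy v b (cube c a)" if y: "y \<in> cube (v + b *\<^sub>R c) (b * a)" for y
  proof -
    let ?x = "(1 / b) *\<^sub>R (y - v)"
    have x: "y = v + b *\<^sub>R ?x" using assms by simp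
    have "\<bar>?x $ i - c $ i\<bar> \<le> a / 2" for i
    proof -
      have "\<bar>b * ?x $ i - b * c $ i\<bar> \<le> b * a / 2"
        using y assms by (simp add: cube_def diff_diff_eq)
      then show ?thesis unfolding scale .
    qed
    then have "?x \<in> cube c a" by (simp add: cube_def)
    moreover note x
    ultimately show ?thesis unfolding affine_copy_def by blast
  qed
  then show ?thesis using scale by (auto simp: affine_copy_def cube_def)
qed

lemma cube_eq_iff:
  fixes c c' :: "real ^ 'd"
  assumes "a > 0" "b > 0"
  shows "cube c a = cube c' b \<longleftrightarrow> c = c' \<and> a = b"
proof
  assume eq: "cube c a = cube c' b"
  have "cube c a \<noteq> {}" using interior_cube_nonempty[OF assms(1)] interior_subset by blast
  then have "\<forall>i. c $ i - a / 2 = c' $ i - b / 2 \<and> c $ i + a / 2 = c' $ i + b / 2"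
    using eq unfolding cube_eq_cbox eq_cbox vec_eq_iff by auto
  then have *: "\<forall>i. c $ i = c' $ i \<and> a = b" by (smt (verit) field_sum_of_halves)
  then show "c = c' \<and> a = b" by (simp add: vec_eq_iff)
qed simp

lemma disjoint_interior_cubes:
  assumes "\<bar>c $ i - c' $ i\<bar> \<ge> (a + b) / 2"
  shows "interior (cube c a) \<inter> interior (cube c' b) = {}"
proof -
  have False if "\<bar>x $ i - c $ i\<bar> < a / 2" "\<bar>x $ i - c' $ i\<bar> < b / 2" for x
    using that assms by argo
  then show ?thesis unfolding interior_cube by blast
qed

section \<open>The substitution scheme\<close>

text \<open>The centres of the grid cubes of side \<open>1/5\<close> in the outer layer: some coordinate is extremal.\<close>

definition shell :: "(real ^ 'd) set" where
  "shell = {z. (\<forall>i. 5 * z $ i \<in> {-2, -1, 0, 1, 2}) \<and> (\<exists>i. \<bar>z $ i\<bar> = 2 / 5)}"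

definition dissection :: "(real ^ 'd) set set" where
  "dissection = insert (cube 0 (3/5)) ((\<lambda>z. cube z (1/5)) ` shell)"

definition cube_scheme :: "('d::finite) scheme" where
  "cube_scheme = \<lparr> protos = [cube 0 1], rule = (\<lambda>_. dissection) \<rparr>"

lemma cube_scheme_simps [simp]:
  "types cube_scheme = {0}" "proto cube_scheme 0 = cube 0 1" "rule cube_scheme i = dissection"
  by (auto simp: cube_scheme_def types_def proto_def)

lemma finite_shell: "finite (shell :: (real ^ 'd) set)"
proof -
  let ?F = "{-2/5, -1/5, 0, 1/5, 2/5} :: real set"
  have "shell \<subseteq> vec_lambda ` (PiE (UNIV :: 'd set) (\<lambda>_. ?F))"
  proof
    fix z :: "real ^ 'd" assume "z \<in> shell"
    have zF: "z $ i \<in> ?F" for i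
    proof -
      have "5 * z $ i \<in> {-2, -1, 0, 1, 2}" using \<open>z \<in> shell\<close> by (simp add: shell_def)
      then show ?thesis unfolding insert_iff empty_iff by argo
    qed
    have "vec_nth z \<in> PiE UNIV (\<lambda>_. ?F)" by (rule PiE_I[OF zF]) simp
    moreover have "z = vec_lambda (vec_nth z)" by simp
    ultimately show "z \<in> vec_lambda ` (PiE UNIV (\<lambda>_. ?F))" by blast
  qed
  then show ?thesis by (rule finite_subset) (intro finite_imageI finite_PiE; simp)
qed

lemma corner_in_shell: "(\<chi> i. 2/5) \<in> shell"
  by (simp add: shell_def)

text \<open>Rounding to the nearest integer, where the ends of the interval are rounded inwards. The last
  property places a point outside the central cube into a cell of the outer layer.\<close>

lemma grid_point_near:
  fixes y :: real
  assumes "\<bar>y\<bar> \<le> 5/2"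
  obtains r where "r \<in> {-2, -1, 0, 1, 2}" "\<bar>y - r\<bar> \<le> 1/2" "\<bar>y\<bar> > 3/2 \<Longrightarrow> \<bar>r\<bar> = 2"
proof -
  consider "y < -3/2" | "-3/2 \<le> y" "y < -1/2" | "-1/2 \<le> y" "y < 1/2" | "1/2 \<le> y" "y \<le> 3/2" | "3/2 < y"
    by linarith
  then show thesis
  proof cases
    case 1 show ?thesis by (rule that[of "-2"]) (use 1 assms in \<open>simp_all, argo?\<close>)
  next
    case 2 show ?thesis by (rule that[of "-1"]) (use 2 assms in \<open>simp_all, argo?\<close>)
  next
    case 3 show ?thesis by (rule that[of "0"]) (use 3 assms in \<open>simp_all, argo?\<close>)
  next
    case 4 show ?thesis by (rule that[of "1"]) (use 4 assms in \<open>simp_all, argo?\<close>)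
  next
    case 5 show ?thesis by (rule that[of "2"]) (use 5 assms in \<open>simp_all, argo?\<close>)
  qed
qed

lemma Union_dissection: "\<Union>dissection = (cube 0 1 :: (real ^ 'd) set)"
proof
  have "x \<in> cube 0 1" if z: "z \<in> shell" and x: "x \<in> cube z (1/5)" for x z :: "real ^ 'd"
  proof -
    have "\<bar>x $ i\<bar> \<le> 1/2" for i
    proof -
      have "\<bar>z $ i\<bar> \<le> 2/5" using z by (auto simp: shell_def dest!: spec[of _ i])
      moreover have "\<bar>x $ i - z $ i\<bar> \<le> 1/10" using x by (auto simp: cube_def dest!: spec[of _ i])
      ultimately show ?thesis by argo
    qed
    then show ?thesis by (simp add: cube_def)
  qed
  moreover have "cube 0 (3/5) \<subseteq> (cube 0 1 :: (real ^ 'd) set)"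
  proof -
    have "\<bar>u\<bar> \<le> 3/5/2 \<Longrightarrow> \<bar>u\<bar> \<le> 1/2" for u :: real by argo
    then show ?thesis unfolding cube_def by (simp only: zero_index diff_0_right) blast
  qed
  ultimately show "\<Union>dissection \<subseteq> (cube 0 1 :: (real ^ 'd) set)"
    unfolding dissection_def by blast
next
  show "cube 0 1 \<subseteq> \<Union>(dissection :: (real ^ 'd) set set)"
  proof
    fix x :: "real ^ 'd" assume x: "x \<in> cube 0 1"
    have "\<exists>r. r \<in> {-2, -1, 0, 1, 2} \<and> \<bar>5 * x $ i - r\<bar> \<le> 1/2 \<and> (\<bar>5 * x $ i\<bar> > 3/2 \<longrightarrow> \<bar>r\<bar> = 2)" for i
    proof -
      have "\<bar>x $ i\<bar> \<le> 1/2" using x by (simp add: cube_def)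
      then have "\<bar>5 * x $ i\<bar> \<le> 5/2" by simp
      then show ?thesis using grid_point_near by metis
    qed
    then obtain r where r: "\<And>i. r i \<in> {-2, -1, 0, 1, 2}" "\<And>i. \<bar>5 * x $ i - r i\<bar> \<le> 1/2"
      "\<And>i. \<bar>5 * x $ i\<bar> > 3/2 \<Longrightarrow> \<bar>r i\<bar> = 2" by metis
    show "x \<in> \<Union>dissection"
    proof (cases "x \<in> cube 0 (3/5)")
      case True
      then show ?thesis by (auto simp: dissection_def)
    next
      case False
      then obtain j where "\<bar>x $ j\<bar> > 3/10" by (auto simp: cube_def not_le)
      then have "\<bar>5 * x $ j\<bar> > 3/2" by simp
      then have j: "\<bar>r j\<bar> = 2" by (rule r)
      define z :: "real ^ 'd" where "z = (\<chi> i. r i / 5)"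
      have "z \<in> shell" unfolding shell_def using r(1) j by (auto simp: z_def intro!: exI[of _ j])
      moreover have "\<bar>x $ i - z $ i\<bar> \<le> 1/10" for i
      proof -
        have "z $ i = r i / 5" by (simp add: z_def)
        then show ?thesis using r(2)[of i] by argo
      qed
      then have "x \<in> cube z (1/5)" by (simp add: cube_def)
      ultimately show ?thesis by (auto simp: dissection_def)
    qed
  qed
qed

text \<open>Two cubes have disjoint interiors once their centres differ, in some coordinate, by at least half
  the sum of the sides. For an outer cube and the central one an extremal coordinate gives
  \<open>2/5 = (3/5 + 1/5) / 2\<close>; two grid cubes differ by \<open>1/5\<close> in a coordinate.\<close>

lemma tessellation_dissection: "tessellation dissection (cube 0 1 :: (real ^ 'd) set)"
proof -
  have centre: "interior (cube 0 (3/5)) \<inter> interior (cube z (1/5)) = {}" if z: "z \<in> shell" for z :: "real ^ 'd"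
  proof -
    obtain i where "\<bar>z $ i\<bar> = 2/5" using z unfolding shell_def by blast
    then show ?thesis by (intro disjoint_interior_cubes[where i = i]) auto
  qed
  have grid: "interior (cube z (1/5)) \<inter> interior (cube w (1/5)) = {}"
    if "z \<in> shell" "w \<in> shell" "z \<noteq> w" for z w :: "real ^ 'd"
  proof -
    obtain i where i: "z $ i \<noteq> w $ i" using \<open>z \<noteq> w\<close> by (auto simp: vec_eq_iff)
    have "5 * z $ i \<in> {-2, -1, 0, 1, 2}" "5 * w $ i \<in> {-2, -1, 0, 1, 2}"
      using that by (auto simp: shell_def)
    then have "\<bar>5 * z $ i - 5 * w $ i\<bar> \<ge> 1" using i by auto
    then have "(1/5 + 1/5) / 2 \<le> \<bar>z $ i - w $ i\<bar>" by argo
    then show ?thesis by (rule disjoint_interior_cubes)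
  qed
  have "interior A \<inter> interior B = {}" if "A \<in> dissection" "B \<in> dissection" "A \<noteq> B" for A B :: "(real ^ 'd) set"
    using that centre grid unfolding dissection_def by blast
  moreover have "\<forall>A\<in>dissection. tile (A :: (real ^ 'd) set)"
    by (auto simp: dissection_def tile_cube)
  ultimately show ?thesis
    using Union_dissection unfolding tessellation_def by blast
qed

lemma tile_of_cube_scheme_iff: "tile_of cube_scheme j a S \<longleftrightarrow> j = 0 \<and> a > 0 \<and> (\<exists>v. S = cube v a)"
  by (auto simp: tile_of_def affine_copy_cube)

lemma multiscale_cube_scheme: "multiscale_scheme (cube_scheme :: ('d::finite) scheme)"
proof -
  have "finite dissection" by (simp add: dissection_def finite_shell)
  moreover have "\<exists>a<1. tile_of cube_scheme 0 a S" if "S \<in> dissection" for S :: "(real ^ 'd) set"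
    using that by (auto simp: dissection_def tile_of_cube_scheme_iff intro: exI[of _ "3/5"] exI[of _ "1/5"])
  ultimately show ?thesis
    using tessellation_dissection by (force simp: multiscale_scheme_def tile_cube)
qed

lemma tile_scale_cube: "a > 0 \<Longrightarrow> tile_scale cube_scheme (cube c a) = a"
  unfolding tile_scale_def tile_of_cube_scheme_iff by (auto simp: cube_eq_iff)

lemma tile_type_cube: "a > 0 \<Longrightarrow> tile_type cube_scheme (cube c a) = 0"
  unfolding tile_type_def tile_of_cube_scheme_iff by (auto intro!: the_equality)

text \<open>A cube determines its centre and side, hence it has only one representation as a scaled translate
  of the prototile.\<close>

lemma subst_tile_cube:
  assumes "a > 0"
  shows "subst_tile cube_scheme (cube c a) = affine_copy c a ` dissection"
proof -
  have rep: "cube c a = affine_copy v b (cube 0 1) \<longleftrightarrow> v = c \<and> b = a" if "b > 0" for v b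
    using assms that by (auto simp: affine_copy_cube cube_eq_iff)
  show ?thesis
  proof
    show "subst_tile cube_scheme (cube c a) \<subseteq> affine_copy c a ` dissection"
    proof
      fix X assume "X \<in> subst_tile cube_scheme (cube c a)"
      then obtain v b R where "b > 0" "cube c a = affine_copy v b (cube 0 1)" "R \<in> dissection"
          "X = affine_copy v b R"
        unfolding subst_tile_def by auto
      then show "X \<in> affine_copy c a ` dissection" using rep[of b v] by blast
    qed
    show "affine_copy c a ` dissection \<subseteq> subst_tile cube_scheme (cube c a)"
      using rep[OF assms, of c] assms unfolding subst_tile_def by force
  qed
qed

lemma affine_copy_dissection:
  assumes "a > 0"
  shows "affine_copy c a ` dissection
    = insert (cube c (3/5 * a)) ((\<lambda>z. cube (c + a *\<^sub>R z) (1/5 * a)) ` shell)"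
  using assms by (simp add: dissection_def affine_copy_cube image_image mult.commute)

lemma interior_affine_copy:
  assumes "a > 0"
  shows "interior (affine_copy c a A) = affine_copy c a (interior A)"
proof -
  have *: "affine_copy c a B = (+) c ` ((\<lambda>x. a *\<^sub>R x) ` B)" for B
    by (simp add: affine_copy_def image_image)
  show ?thesis
    unfolding * interior_translation
    using assms by (simp add: interior_injective_linear_image inj_on_def linear_scaleR)
qed

lemma tessellation_subst_tile_cube:
  assumes a: "a > 0"
  shows "tessellation (subst_tile cube_scheme (cube c a)) (cube c a)"
proof -
  have inj: "inj (\<lambda>x. c + a *\<^sub>R x)" using a by (auto simp: inj_on_def)
  have "interior A \<inter> interior B = {}"
    if A: "A \<in> affine_copy c a ` dissection" and B: "B \<in> affine_copy c a ` dissection"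
      and "A \<noteq> B" for A B
  proof -
    obtain A' B' where AB: "A' \<in> dissection" "B' \<in> dissection" "A = affine_copy c a A'" "B = affine_copy c a B'"
      using A B by blast
    then have "interior A' \<inter> interior B' = {}"
      using \<open>A \<noteq> B\<close> by (intro tessellation_disjoint_interiors[OF tessellation_dissection]) auto
    then show ?thesis
      unfolding AB(3,4) interior_affine_copy[OF a] unfolding affine_copy_def
      using inj by (simp add: image_Int[symmetric])
  qed
  moreover have "\<forall>A\<in>affine_copy c a ` dissection. tile A"
    using a by (auto simp: affine_copy_dissection tile_cube)
  moreover have "\<Union>(affine_copy c a ` dissection) = cube c a"
  proof -
    have "\<Union>(affine_copy c a ` dissection) = affine_copy c a (\<Union>dissection)"
      by (auto simp: affine_copy_def)
    then show ?thesis using a by (simp add: Union_dissection affine_copy_cube)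
  qed
  ultimately show ?thesis unfolding subst_tile_cube[OF a] tessellation_def by blast
qed

section \<open>Scales of tiles in iterated substitutions\<close>

definition cubes_with_scales :: "(real \<Rightarrow> bool) \<Rightarrow> (real ^ 'd) set set \<Rightarrow> bool" where
  "cubes_with_scales I P \<longleftrightarrow> (\<forall>S\<in>P. \<exists>c x. 0 < x \<and> I x \<and> S = cube c x)"

text \<open>One step keeps the cubes of side at most \<open>1\<close> and contracts the others by \<open>3/5\<close> or \<open>1/5\<close>. With
  \<open>I = J\<close> this is the step of an invariant; different \<open>I\<close> and \<open>J\<close> serve for the bound on the sides
  that improves from step to step and gives termination.\<close>

lemma cubes_with_scales_subst_large:
  assumes P: "cubes_with_scales I P"
    and small: "\<And>x. I x \<Longrightarrow> 0 < x \<Longrightarrow> x \<le> 1 \<Longrightarrow> J x"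
    and large: "\<And>x. I x \<Longrightarrow> 1 < x \<Longrightarrow> J (3/5 * x) \<and> J (1/5 * x)"
  shows "cubes_with_scales J (subst_large cube_scheme P)"
  unfolding cubes_with_scales_def
proof
  fix S assume "S \<in> subst_large cube_scheme P"
  then obtain R where R: "R \<in> P" "S \<in> (if measure lebesgue R > 1 then subst_tile cube_scheme R else {R})"
    unfolding subst_large_def by blast
  then obtain c x where x: "0 < x" "I x" "R = cube c x"
    using P unfolding cubes_with_scales_def by blast
  show "\<exists>c x. 0 < x \<and> J x \<and> S = cube c x"
  proof (cases "x > 1")
    case True
    then have "S \<in> affine_copy c x ` dissection"
      using R x by (simp add: measure_cube_gt_1_iff subst_tile_cube)
    then consider "S = cube c (3/5 * x)" | z where "S = cube (c + x *\<^sub>R z) (1/5 * x)"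
      using x by (auto simp: affine_copy_dissection)
    then show ?thesis
    proof cases
      case 1
      moreover have "0 < 3/5 * x" using x by simp
      ultimately show ?thesis using large[OF x(2) True] by blast
    next
      case 2
      moreover have "0 < 1/5 * x" using x by simp
      ultimately show ?thesis using large[OF x(2) True] by blast
    qed
  next
    case False
    then have "S = cube c x" "J x" using R x small by (auto simp: measure_cube_gt_1_iff)
    then show ?thesis using x by blast
  qed
qed

lemma cubes_with_scales_funpow:
  assumes "cubes_with_scales I P" and "\<And>x. I x \<Longrightarrow> 1 < x \<Longrightarrow> I (3/5 * x) \<and> I (1/5 * x)"
  shows "cubes_with_scales I ((subst_large cube_scheme ^^ m) P)"
  by (induction m) (use assms in \<open>auto intro: cubes_with_scales_subst_large\<close>)

lemma tessellation_funpow_subst_large: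
  assumes "tessellation P U" "cubes_with_scales (\<lambda>_. True) P"
  shows "tessellation ((subst_large cube_scheme ^^ m) P) U"
proof (induction m)
  case (Suc m)
  let ?P = "(subst_large cube_scheme ^^ m) P"
  have "cubes_with_scales (\<lambda>_. True) ?P"
    using assms(2) by (rule cubes_with_scales_funpow) simp
  then have "tessellation (if measure lebesgue S > 1 then subst_tile cube_scheme S else {S}) S"
    if S: "S \<in> ?P" for S
  proof -
    obtain c x where "0 < x" "S = cube c x"
      using \<open>cubes_with_scales _ ?P\<close> S unfolding cubes_with_scales_def by blast
    then show ?thesis
      using tessellation_subst_tile_cube[of x c] tile_cube[of x c] by (auto simp: tessellation_def)
  qed
  then show ?case
    unfolding funpow.simps comp_def
    by (subst subst_large_def) (rule tessellation_refine[OF Suc])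
qed (use assms in simp)

text \<open>After \<open>m\<close> steps every cube either is small or has been contracted \<open>m\<close> times by a factor of at
  most \<open>3/5\<close>.\<close>

lemma substitution_terminates:
  fixes c :: "real ^ 'd"
  assumes "a > 0"
  obtains m where "\<forall>S\<in>(subst_large cube_scheme ^^ m) {cube c a}. measure lebesgue S \<le> 1"
proof -
  have bound: "cubes_with_scales (\<lambda>x. x \<le> max 1 (a * (3/5) ^ m)) ((subst_large cube_scheme ^^ m) {cube c a})" for m
  proof (induction m)
    case 0
    show ?case using assms
      by (auto simp: cubes_with_scales_def intro!: exI[of _ c] exI[of _ a])
  next
    case (Suc m)
    show ?case unfolding funpow.simps comp_def
      by (rule cubes_with_scales_subst_large[OF Suc]) (auto simp: le_max_iff_disj)
  qed
  have "(\<lambda>m. a * (3/5) ^ m) \<longlonglongrightarrow> a * 0"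
    by (intro tendsto_intros) simp
  then have "eventually (\<lambda>m. a * (3/5) ^ m < 1) sequentially"
    by (rule order_tendstoD) simp
  then obtain m where "a * (3/5) ^ m < 1" by (auto simp: eventually_sequentially)
  then have "\<forall>S\<in>(subst_large cube_scheme ^^ m) {cube c a}. measure lebesgue S \<le> 1"
    using bound[of m] by (force simp: cubes_with_scales_def measure_cube_le_1_iff)
  then show thesis by (rule that)
qed

text \<open>The number of iterations in \<open>flow\<close> is a least one that depends on the starting cube. Since any
  larger number gives the same patch, flows from different cubes can be compared after a common
  number of steps.\<close>

lemma flow_cube_stabilises:
  fixes Q :: "(real ^ 'd::finite) set"
  assumes Q: "Q = cube 0 1"
  obtains n where "\<And>m. n \<le> m \<Longrightarrow>
      flow cube_scheme t Q = (subst_large cube_scheme ^^ m) {cube 0 (exp t)}"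
    and "\<forall>S\<in>flow cube_scheme t Q. measure lebesgue S \<le> 1"
proof -
  have e: "affine_copy 0 (exp t) Q = cube 0 (exp t)" by (simp add: Q affine_copy_cube)
  obtain n where n: "\<forall>S\<in>(subst_large cube_scheme ^^ n) {cube 0 (exp t) :: (real ^ 'd) set}. measure lebesgue S \<le> 1"
    using substitution_terminates[of "exp t" 0] by auto
  then have *: "flow cube_scheme t Q = (subst_large cube_scheme ^^ n) {cube 0 (exp t)}"
    using flow_eq_funpow[where \<sigma> = cube_scheme and m = n and t = t and T = Q] by (simp add: e)
  show thesis
  proof (rule that)
    show "flow cube_scheme t Q = (subst_large cube_scheme ^^ m) {cube 0 (exp t)}" if "n \<le> m" for m
      using * funpow_subst_large_stable[OF n that] by simp
    show "\<forall>S\<in>flow cube_scheme t Q. measure lebesgue S \<le> 1"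
      unfolding * by (rule n)
  qed
qed

lemma small_tile_in_flow:
  fixes S :: "(real ^ 'd::finite) set"
  assumes "S \<in> (subst_large cube_scheme ^^ m) {cube 0 (exp t)}" "measure lebesgue S \<le> 1"
  shows "S \<in> flow cube_scheme t (cube 0 1)"
proof -
  obtain n where "\<And>m. n \<le> m \<Longrightarrow> flow cube_scheme t (cube 0 1)
      = (subst_large cube_scheme ^^ m) {cube 0 (exp t) :: (real ^ 'd) set}"
    using flow_cube_stabilises[OF refl] by blast
  then have "flow cube_scheme t (cube 0 1 :: (real ^ 'd) set) = (subst_large cube_scheme ^^ (max m n)) {cube 0 (exp t)}"
    by simp
  then show ?thesis using small_tile_persists[OF assms, of "max m n"] by simp
qed

lemma flow_cube_invariant:
  fixes Q :: "(real ^ 'd::finite) set"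
  assumes Q: "Q = cube 0 1" and "I (exp t)" "\<And>x. I x \<Longrightarrow> 1 < x \<Longrightarrow> I (3/5 * x) \<and> I (1/5 * x)"
  shows "cubes_with_scales (\<lambda>x. I x \<and> x \<le> 1) (flow cube_scheme t Q)"
proof -
  obtain n where n: "\<And>m. n \<le> m \<Longrightarrow>
      flow cube_scheme t Q = (subst_large cube_scheme ^^ m) {cube 0 (exp t)}"
    and small: "\<forall>S\<in>flow cube_scheme t Q. measure lebesgue S \<le> 1"
    using flow_cube_stabilises[OF Q] by blast
  have "cubes_with_scales I {cube 0 (exp t) :: (real ^ 'd) set}"
    unfolding cubes_with_scales_def using assms(2) exp_gt_zero by blast
  then have "cubes_with_scales I (flow cube_scheme t Q)"
    unfolding n[OF order_refl] using assms(3) by (rule cubes_with_scales_funpow)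
  then show ?thesis using small
    unfolding cubes_with_scales_def by (metis measure_cube_le_1_iff)
qed

lemma flow_cube_tessellation:
  "tessellation (flow cube_scheme t (cube 0 1)) (cube 0 (exp t) :: (real ^ 'd::finite) set)"
proof -
  obtain n where n: "\<And>m. n \<le> m \<Longrightarrow> flow cube_scheme t (cube 0 1)
      = (subst_large cube_scheme ^^ m) {cube 0 (exp t) :: (real ^ 'd) set}"
    using flow_cube_stabilises[OF refl] by blast
  show ?thesis unfolding n[OF order_refl]
    by (rule tessellation_funpow_subst_large)
      (auto simp: tessellation_def tile_cube cubes_with_scales_def intro: exp_gt_zero)
qed

section \<open>The stationary tiling\<close>

definition inflation_time :: real where
  "inflation_time = ln (5/3)"

lemma exp_inflation_time: "exp (real k * inflation_time) = (5/3) ^ k"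
  by (simp add: exp_of_nat_mult inflation_time_def)

definition supertile :: "nat \<Rightarrow> (real ^ 'd::finite) set set" where
  "supertile k = flow cube_scheme (real k * inflation_time) (cube 0 1)"

definition cube_tiling :: "(real ^ 'd::finite) set set" where
  "cube_tiling = (\<Union>k. supertile k)"

lemma supertile_0: "supertile 0 = {cube 0 1}"
proof -
  have "flow cube_scheme 0 (cube 0 1) = (subst_large cube_scheme ^^ 0) {affine_copy 0 (exp 0) (cube 0 1)}"
    by (rule flow_eq_funpow) (simp add: measure_cube)
  then show ?thesis by (simp add: supertile_def)
qed

lemma central_cube_in_subst_large:
  assumes "x > 1"
  shows "cube 0 (3/5 * x) \<in> subst_large cube_scheme {cube 0 x}"
  using assms by (simp add: subst_large_def measure_cube_gt_1_iff subst_tile_cube affine_copy_dissection)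

lemma supertile_eq_funpow:
  obtains n where "\<And>m. n \<le> m \<Longrightarrow>
      supertile k = (subst_large cube_scheme ^^ m) {cube 0 ((5/3) ^ k) :: (real ^ 'd::finite) set}"
proof (rule flow_cube_stabilises[OF refl, of "real k * inflation_time"])
  fix n
  assume "\<And>m. n \<le> m \<Longrightarrow> flow cube_scheme (real k * inflation_time) (cube 0 1)
      = (subst_large cube_scheme ^^ m) {cube 0 (exp (real k * inflation_time)) :: (real ^ 'd) set}"
  then show thesis unfolding exp_inflation_time supertile_def[symmetric] by (rule that)
qed

text \<open>Substituting once in the cube of side \<open>(5/3) ^ Suc k\<close> produces the cube of side \<open>(5/3) ^ k\<close> in the
  centre, and from there on its descendants form the smaller patch. Hence the two patches are
  compared at numbers of iterations that differ by one.\<close>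

lemma supertile_mono_Suc: "supertile k \<subseteq> (supertile (Suc k) :: (real ^ 'd::finite) set set)"
proof -
  let ?F = "subst_large (cube_scheme :: 'd scheme)"
  obtain n where n: "\<And>m. n \<le> m \<Longrightarrow> supertile k = (?F ^^ m) {cube 0 ((5/3) ^ k)}"
    using supertile_eq_funpow by blast
  obtain n' where n': "\<And>m. n' \<le> m \<Longrightarrow> supertile (Suc k) = (?F ^^ m) {cube 0 ((5/3) ^ Suc k)}"
    using supertile_eq_funpow by blast
  have "(1::real) < (5/3) ^ Suc k" by (rule one_less_power) auto
  then have "cube 0 ((5/3) ^ k) \<in> ?F {cube 0 ((5/3) ^ Suc k)}"
    using central_cube_in_subst_large[of "(5/3) ^ Suc k"] by simp
  then have "(?F ^^ max n n') {cube 0 ((5/3) ^ k)} \<subseteq> (?F ^^ max n n') (?F {cube 0 ((5/3) ^ Suc k)})"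
    by (intro funpow_subst_large_mono) simp
  then show ?thesis
    using n[of "max n n'"] n'[of "Suc (max n n')"] by (simp add: funpow_swap1 le_SucI)
qed

lemma supertile_mono: "i \<le> j \<Longrightarrow> supertile i \<subseteq> supertile j"
  by (rule lift_Suc_mono_le[of supertile, OF supertile_mono_Suc])

lemma supertile_tessellation: "tessellation (supertile k) (cube 0 ((5/3) ^ k))"
  using flow_cube_tessellation[of "real k * inflation_time"]
  by (simp add: supertile_def exp_inflation_time)

lemma supertile_cubes:
  fixes S :: "(real ^ 'd::finite) set"
  assumes "S \<in> supertile k"
  obtains c x where "x > 0" "S = cube c x"
  using flow_cube_invariant[OF refl, of "\<lambda>_. True" "real k * inflation_time"] assms
  unfolding cubes_with_scales_def supertile_def by auto

lemma bounded_subset_supertile_support: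
  fixes B :: "(real ^ 'd) set"
  assumes "bounded B"
  obtains k where "B \<subseteq> cube 0 ((5/3) ^ k)"
proof -
  obtain r where r: "\<And>x. x \<in> B \<Longrightarrow> norm x \<le> r" using assms by (auto simp: bounded_iff)
  obtain k where k: "2 * r < (5/3) ^ k" using real_arch_pow[of "5/3" "2 * r"] by auto
  have "x \<in> cube 0 ((5/3) ^ k)" if "x \<in> B" for x
  proof -
    have "\<bar>x $ i\<bar> \<le> (5/3) ^ k / 2" for i
      using component_le_norm_cart[of x i] r[OF that] k by argo
    then show ?thesis by (simp add: cube_def)
  qed
  then show thesis using that by blast
qed

lemma tiling_cube_tiling: "tiling (cube_tiling :: (real ^ 'd::finite) set set)"
proof -
  have "tessellation (cube_tiling :: (real ^ 'd) set set) (\<Union>k. cube 0 ((5/3) ^ k))"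
    unfolding cube_tiling_def
    by (rule tessellation_nested_Union) (rule supertile_tessellation supertile_mono_Suc)+
  moreover have "x \<in> (\<Union>k. cube 0 ((5/3) ^ k))" for x :: "real ^ 'd"
    using bounded_subset_supertile_support[of "{x}"] by auto
  then have "(\<Union>k. cube 0 ((5/3) ^ k)) = (UNIV :: (real ^ 'd) set)" by blast
  ultimately show ?thesis by (simp add: tiling_def)
qed

lemma subpatch_in_supertile:
  fixes P :: "(real ^ 'd::finite) set set"
  assumes P: "P \<subseteq> cube_tiling" "patch P"
  obtains k where "P \<subseteq> supertile k"
proof -
  have "bounded (\<Union>P)" using \<open>patch P\<close> by (auto simp: patch_def tessellation_def)
  then obtain k where k: "\<Union>P \<subseteq> cube 0 ((5/3) ^ k)" by (rule bounded_subset_supertile_support)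
  have "S \<in> supertile k" if "S \<in> P" for S
  proof (rule tile_within_support_mem)
    show "tessellation cube_tiling UNIV" using tiling_cube_tiling by (simp add: tiling_def)
    show "tessellation (supertile k) (cube 0 ((5/3) ^ k))" by (rule supertile_tessellation)
    show "supertile k \<subseteq> cube_tiling" by (auto simp: cube_tiling_def)
    show "A \<subseteq> closure (interior A)" if "A \<in> supertile k" for A
      using supertile_cubes[OF that] cube_subset_closure_interior by metis
    show S: "S \<in> cube_tiling" "S \<subseteq> cube 0 ((5/3) ^ k)" using that P k by auto
    then obtain j where "S \<in> supertile j" by (auto simp: cube_tiling_def)
    then show "interior S \<noteq> {}" using supertile_cubes interior_cube_nonempty by metis
  qed
  then show thesis using that by blast
qed

lemma cube_tiling_in_tiling_space:
  "cube_tiling \<in> tiling_space (cube_scheme :: ('d::finite) scheme)"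
proof -
  have "\<exists>Q. (\<forall>m::nat. \<exists>G\<in>generating_patches cube_scheme. \<exists>G'\<subseteq>G. \<exists>v. Q m = affine_copy v 1 ` G')
        \<and> (\<lambda>m. set_dist (skeleton (Q m)) (skeleton P)) \<longlonglongrightarrow> 0"
    if P: "P \<subseteq> cube_tiling" "patch P" for P :: "(real ^ 'd) set set"
  proof -
    obtain k where k: "P \<subseteq> supertile k" using P by (rule subpatch_in_supertile)
    have "supertile k \<in> generating_patches (cube_scheme :: 'd scheme)"
      unfolding generating_patches_def supertile_def inflation_time_def
      by (auto intro!: exI[of _ "real k * ln (5/3)"])
    moreover have "P = affine_copy 0 1 ` P" by simp
    ultimately have "\<exists>G\<in>generating_patches cube_scheme. \<exists>G'\<subseteq>G. \<exists>v. P = affine_copy v 1 ` G'"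
      using k by blast
    then show ?thesis
      by (intro exI[of _ "\<lambda>_. P"]) (simp add: set_dist_self)
  qed
  then show ?thesis using tiling_cube_tiling by (simp add: tiling_space_def)
qed

lemma centre_in_supertile_1: "cube 0 1 \<in> supertile 1"
  using supertile_mono[of 0 1] by (simp add: supertile_0)

text \<open>A path of length one cannot be a repetition of a nonempty path.\<close>

lemma primitive_loop:
  "primitive_closed_path cube_scheme [(0, cube 0 (3/5) :: (real ^ 'd::finite) set)]"
  (is "primitive_closed_path _ [?e]")
proof -
  have "pre_digraph.awalk (scheme_graph cube_scheme) 0 [?e] 0"
    by (simp add: pre_digraph.awalk_def pre_digraph.cas.simps scheme_graph_def tile_type_cube dissection_def)
  then have "closed_path cube_scheme [?e]" unfolding closed_path_def by blast
  moreover have "\<not> (\<exists>q m. m \<ge> 2 \<and> closed_path cube_scheme q \<and> [?e] = concat (replicate m q))"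
  proof safe
    fix q :: "(nat \<times> (real ^ 'd) set) list" and m :: nat
    assume "2 \<le> m" "closed_path cube_scheme q" and e: "[?e] = concat (replicate m q)"
    have "length (concat (replicate m q)) = m * length q"
      by (simp add: length_concat sum_list_replicate)
    then have "1 = m * length q" using e[symmetric] by simp
    then show False using \<open>2 \<le> m\<close> by simp
  qed
  ultimately show ?thesis unfolding primitive_closed_path_def by blast
qed

text \<open>The inflation by \<open>5/3\<close> fixes the common centre of the prototile and of its central cube, so
  the prototile needs no translation and the time offset is \<open>0\<close>.\<close>

lemma stationary_cube_tiling:
  "stationary_tiling (cube_scheme :: ('d::finite) scheme) inflation_time cube_tiling"
proof -
  let ?Q = "cube 0 1 :: (real ^ 'd) set"
  have s: "0 < inflation_time" by (simp add: inflation_time_def)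
  have Q: "?Q \<in> flow cube_scheme inflation_time ?Q"
    using centre_in_supertile_1 by (simp add: supertile_def)
  have "ancestry cube_scheme (affine_copy 0 (exp inflation_time) ?Q) [(0, cube 0 (3/5))] ?Q"
  proof (rule ancestry_Cons)
    show "affine_copy 0 (exp inflation_time) ?Q = affine_copy 0 (5/3) (proto cube_scheme 0)"
      by (simp add: inflation_time_def)
    show "measure lebesgue (affine_copy 0 (exp inflation_time) ?Q) > 1"
      by (simp add: affine_copy_cube measure_cube_gt_1_iff s)
    have "affine_copy 0 (5/3) (cube 0 (3/5)) = ?Q" by (simp add: affine_copy_cube)
    then show "ancestry cube_scheme (affine_copy 0 (5/3) (cube 0 (3/5))) [] ?Q"
      using ancestry_Nil by metis
  qed (auto simp: dissection_def)
  moreover have "sum_list (map (edge_length cube_scheme) [(0, cube 0 (3/5) :: (real ^ 'd) set)]) = inflation_time"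
    by (simp add: edge_length_def tile_scale_cube inflation_time_def)
  ultimately have path: "\<exists>p. ancestry cube_scheme (affine_copy 0 (exp inflation_time) ?Q) p ?Q
      \<and> sum_list (map (edge_length cube_scheme) p) = inflation_time \<and> primitive_closed_path cube_scheme p"
    using primitive_loop by blast
  have "inflation_time \<in> return_times (cube_scheme :: 'd scheme) 0"
    using s Q unfolding return_times_def tile_of_cube_scheme_iff
    by (auto simp: measure_cube intro!: bexI[of _ ?Q] exI[of _ "1::real"])
  moreover have "0 \<in> interior ?Q" by (simp add: interior_cube)
  moreover have "flow cube_scheme (0 + real k * inflation_time) ?Q \<subseteq> flow cube_scheme (0 + real (Suc k) * inflation_time) ?Q" for k
    using supertile_mono_Suc[of k] by (simp only: supertile_def add_0)
  moreover have "cube_tiling = (\<Union>k. flow cube_scheme (0 + real k * inflation_time) ?Q)"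
    by (simp add: cube_tiling_def supertile_def)
  ultimately show ?thesis
    unfolding stationary_tiling_def
    using s Q path cube_tiling_in_tiling_space
    by (intro conjI bexI[of _ 0] exI[of _ "0::real"] exI[of _ "0 :: real ^ 'd"] exI[of _ ?Q]) auto
qed

lemma presented_cube_tiling: "presented_by cube_scheme inflation_time (cube 0 1) cube_tiling"
  using supertile_mono_Suc unfolding presented_by_def tile_of_cube_scheme_iff cube_tiling_def supertile_def
  by (auto intro!: exI[of _ "1::real"])

section \<open>Incommensurability and irreducibility\<close>

text \<open>Compare the exponents of the prime 3 after clearing denominators.\<close>

lemma scale_power_inj:
  assumes "(5/3) ^ j / 5 ^ m = ((5/3) ^ j' / 5 ^ m' :: real)"
  shows "j = j'"
proof -
  have "(5::real) ^ j * 3 ^ j' * 5 ^ m' = 5 ^ j' * 3 ^ j * 5 ^ m"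
    using assms by (simp add: power_divide field_simps)
  then have "real (3 ^ j' * 5 ^ (j + m')) = real (3 ^ j * 5 ^ (j' + m))"
    by (simp add: power_add algebra_simps)
  then have eq: "3 ^ j' * 5 ^ (j + m') = (3 ^ j * 5 ^ (j' + m) :: nat)"
    using of_nat_eq_iff by blast
  have "multiplicity 3 (3 ^ a * 5 ^ b :: nat) = a" for a b
  proof -
    have "\<not> 3 dvd (5 ^ b :: nat)" using prime_dvd_power[of "3::nat" 5 b] by auto
    then show ?thesis
      by (intro multiplicity_eqI) (simp_all add: power_Suc2 del: power_Suc)
  qed
  then show ?thesis using eq by metis
qed

text \<open>The central cube returns to unit volume at time \<open>ln (5/3)\<close>, a cube of the outer layer at time
  \<open>ln 5\<close>.\<close>

lemma incommensurable_cube_scheme: "incommensurable (cube_scheme :: ('d::finite) scheme)"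
proof -
  have unit: "t \<in> return_times (cube_scheme :: 'd scheme) 0"
    if "t \<ge> 0" "cube c 1 \<in> flow cube_scheme t (cube 0 1 :: (real ^ 'd) set)" for t c
    using that unfolding return_times_def tile_of_cube_scheme_iff
    by (auto simp: measure_cube intro!: bexI[of _ "cube c 1"] exI[of _ "1::real"])
  have "inflation_time \<in> return_times (cube_scheme :: 'd scheme) 0"
    using centre_in_supertile_1
    by (intro unit[of _ 0]) (simp_all add: supertile_def inflation_time_def)
  moreover have "ln 5 \<in> return_times (cube_scheme :: 'd scheme) 0"
  proof (rule unit)
    have "cube (0 + 5 *\<^sub>R (\<chi> i. 2/5)) 1 \<in> (subst_large cube_scheme ^^ 1) {cube 0 (exp (ln 5)) :: (real ^ 'd) set}"
      using corner_in_shell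
      by (auto simp: subst_large_def measure_cube_gt_1_iff subst_tile_cube affine_copy_dissection)
    then show "cube (0 + 5 *\<^sub>R (\<chi> i. 2/5)) 1 \<in> flow cube_scheme (ln 5) (cube 0 1 :: (real ^ 'd) set)"
      by (rule small_tile_in_flow) (simp add: measure_cube)
  qed simp
  moreover have "inflation_time \<noteq> q * ln 5" if "q \<in> \<rat>" for q
  proof
    assume q: "inflation_time = q * ln 5"
    have "inflation_time > 0" by (simp add: inflation_time_def)
    then have "q > 0" unfolding q by (simp add: zero_less_mult_iff)
    obtain a b :: nat where "b \<noteq> 0" "\<bar>q\<bar> = real a / real b"
      using \<open>q \<in> \<rat>\<close> by (rule Rats_abs_nat_div_natE)
    then have "real b * ln (5/3) = real a * ln 5"
      using q \<open>q > 0\<close> by (simp add: inflation_time_def)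
    then have "exp (real b * ln (5/3)) = exp (real a * ln 5)" by simp
    then have "(5/3) ^ b = (5::real) ^ a" by (simp add: exp_of_nat_mult)
    then have "(5/3) ^ b / 5 ^ a = ((5/3) ^ 0 / 5 ^ 0 :: real)" by simp
    then have "b = 0" by (rule scale_power_inj)
    then show False using \<open>b \<noteq> 0\<close> by simp
  qed
  moreover have "inflation_time > 0" "ln 5 > (0::real)" by (simp_all add: inflation_time_def)
  ultimately have "\<exists>t1\<in>return_times (cube_scheme :: 'd scheme) 0. \<exists>t2\<in>return_times (cube_scheme :: 'd scheme) 0.
      t1 > 0 \<and> t2 > 0 \<and> \<not> (\<exists>q\<in>\<rat>. t1 = q * t2)" by blast
  then show ?thesis by (simp add: incommensurable_def)
qed

text \<open>With one type of tiles, any patch at a positive time will do.\<close>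

lemma irreducible_cube_scheme: "irreducible_scheme (cube_scheme :: ('d::finite) scheme)"
proof -
  have "\<exists>t>0. \<exists>S\<in>flow cube_scheme t (cube 0 1 :: (real ^ 'd) set). \<exists>a. tile_of cube_scheme 0 a S"
  proof (rule exI[of _ inflation_time], intro conjI bexI[of _ "cube 0 1"])
    show "cube 0 1 \<in> flow cube_scheme inflation_time (cube 0 1)"
      using centre_in_supertile_1 by (simp add: supertile_def)
    show "\<exists>a. tile_of cube_scheme 0 a (cube 0 1 :: (real ^ 'd) set)"
      unfolding tile_of_cube_scheme_iff by (auto intro: exI[of _ "1::real"])
  qed (simp add: inflation_time_def)
  then show ?thesis by (simp add: irreducible_scheme_def)
qed

section \<open>Tile complexity\<close>

text \<open>The length of a descent from the cube of side \<open>(5/3) ^ j\<close> through outer cubes only.\<close>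

definition shrink_count :: "nat \<Rightarrow> nat" where
  "shrink_count j = (LEAST m. (5/3 :: real) ^ j / 5 ^ m \<le> 1)"

lemma shrink_count_le_iff: "shrink_count j \<le> m \<longleftrightarrow> (5/3 :: real) ^ j / 5 ^ m \<le> 1"
proof
  assume le: "(5/3 :: real) ^ j / 5 ^ m \<le> 1"
  then show "shrink_count j \<le> m" unfolding shrink_count_def by (rule Least_le)
next
  assume m: "shrink_count j \<le> m"
  have "(5/3 :: real) ^ j \<le> 5 ^ j" by (rule power_mono) auto
  then have "(5/3 :: real) ^ j / 5 ^ j \<le> 1" by simp
  then have "(5/3 :: real) ^ j / 5 ^ shrink_count j \<le> 1"
    unfolding shrink_count_def by (rule LeastI)
  then have "(5/3 :: real) ^ j \<le> 5 ^ shrink_count j" by simp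
  also have "\<dots> \<le> 5 ^ m" using m by (rule power_increasing) simp
  finally show "(5/3 :: real) ^ j / 5 ^ m \<le> 1" by simp
qed

definition final_scale :: "nat \<Rightarrow> real" where
  "final_scale j = (5/3) ^ j / 5 ^ shrink_count j"

lemma final_scale_pos: "final_scale j > 0"
  by (simp add: final_scale_def)

lemma final_scale_le_1: "final_scale j \<le> 1"
  unfolding final_scale_def using shrink_count_le_iff by blast

lemma inj_final_scale: "inj final_scale"
  unfolding inj_def final_scale_def using scale_power_inj by blast

text \<open>The invariant is that all sides have the form \<open>(5/3) ^ j / 5 ^ i\<close> with \<open>j \<le> k\<close> and
  \<open>i \<le> shrink_count j\<close>; a tile of side at most \<open>1\<close> then has \<open>i = shrink_count j\<close>. The critical step
  is the passage from \<open>j\<close> to \<open>j - 1\<close>, where \<open>shrink_count\<close> may drop. It drops by at most one, since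
  \<open>(5/3) ^ (j - 1) / 5 ^ (i - 1)\<close> is three times the side of the substituted cube and hence larger
  than \<open>1\<close>.\<close>

lemma supertile_scales_subset:
  "cubes_with_scales (\<lambda>x. x \<in> final_scale ` {..k}) (supertile k :: (real ^ 'd::finite) set set)"
proof -
  define I where "I = (\<lambda>x::real. \<exists>j i. j \<le> k \<and> i \<le> shrink_count j \<and> x = (5/3) ^ j / 5 ^ i)"
  have step: "I (3/5 * x) \<and> I (1/5 * x)" if "I x" "1 < x" for x
  proof -
    obtain j i where ji: "j \<le> k" "i \<le> shrink_count j" "x = (5/3) ^ j / 5 ^ i"
      using \<open>I x\<close> unfolding I_def by blast
    have i: "i < shrink_count j"
      using shrink_count_le_iff[of j i] ji \<open>1 < x\<close> by linarith
    \<comment> \<open>A cube of side larger than \<open>1\<close> has \<open>j > 0\<close>, so no cube reaches a negative exponent.\<close>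
    have "j \<noteq> 0"
    proof
      assume "j = 0"
      then have "shrink_count j \<le> 0" unfolding shrink_count_le_iff by simp
      then show False using i by simp
    qed
    then obtain j' where j': "j = Suc j'" by (cases j) auto
    have "i \<le> shrink_count j'"
    proof (cases i)
      case (Suc i')
      have "(5/3) ^ j' / 5 ^ i' = 3 * x" unfolding ji j' Suc by simp
      then have "\<not> shrink_count j' \<le> i'" unfolding shrink_count_le_iff using \<open>1 < x\<close> by simp
      then show ?thesis using Suc by simp
    qed simp
    moreover have "3/5 * x = (5/3) ^ j' / 5 ^ i" unfolding ji j' by simp
    ultimately have "I (3/5 * x)" using ji j' unfolding I_def by (intro exI[of _ j'] exI[of _ i]) simp
    moreover have "1/5 * x = (5/3) ^ j / 5 ^ Suc i" unfolding ji by simp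
    then have "I (1/5 * x)" using ji i unfolding I_def by (intro exI[of _ j] exI[of _ "Suc i"]) simp
    ultimately show ?thesis ..
  qed
  have "I (exp (real k * inflation_time))"
    unfolding exp_inflation_time I_def by (intro exI[of _ k] exI[of _ 0]) simp
  then have "cubes_with_scales (\<lambda>x. I x \<and> x \<le> 1) (supertile k :: (real ^ 'd) set set)"
    unfolding supertile_def using step by (rule flow_cube_invariant[OF refl])
  moreover have "x \<in> final_scale ` {..k}" if "I x" "x \<le> 1" for x
  proof -
    obtain j i where ji: "j \<le> k" "i \<le> shrink_count j" "x = (5/3) ^ j / 5 ^ i"
      using \<open>I x\<close> unfolding I_def by blast
    then have "i = shrink_count j" using shrink_count_le_iff[of j i] \<open>x \<le> 1\<close> by simp
    then show ?thesis using ji by (auto simp: final_scale_def)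
  qed
  ultimately show ?thesis unfolding cubes_with_scales_def by metis
qed

text \<open>Starting from the cube of side \<open>(5/3) ^ j\<close>, follow the outer cubes down to the first one of side at
  most \<open>1\<close>; the result lies in the patch with index \<open>j\<close> and, by nestedness, in all later ones.\<close>

lemma final_scale_in_supertile:
  assumes "j \<le> k"
  shows "\<exists>c. cube c (final_scale j) \<in> (supertile k :: (real ^ 'd::finite) set set)"
proof -
  let ?P = "\<lambda>i. (subst_large cube_scheme ^^ i) {cube 0 ((5/3) ^ j) :: (real ^ 'd) set}"
  have "\<exists>c. cube c ((5/3) ^ j / 5 ^ i) \<in> ?P i" if "i \<le> shrink_count j" for i
    using that
  proof (induction i)
    case 0
    then show ?case by auto
  next
    case (Suc i)
    let ?x = "(5/3) ^ j / 5 ^ i :: real"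
    obtain c where c: "cube c ?x \<in> ?P i" using Suc by auto
    have x: "1 < ?x" using shrink_count_le_iff[of j i] Suc.prems by linarith
    then have x0: "0 < ?x" by linarith
    have "cube (c + ?x *\<^sub>R (\<chi> i. 2/5)) (1/5 * ?x) \<in> subst_tile cube_scheme (cube c ?x)"
      unfolding subst_tile_cube[OF x0] affine_copy_dissection[OF x0]
      by (intro insertI2 imageI corner_in_shell)
    then have "cube (c + ?x *\<^sub>R (\<chi> i. 2/5)) (1/5 * ?x) \<in> ?P (Suc i)"
      unfolding funpow.simps comp_def
      using c x x0 by (auto intro: subst_large_memI simp: measure_cube_gt_1_iff)
    then show ?case by (auto simp: mult.commute)
  qed
  then obtain c where "cube c (final_scale j) \<in> ?P (shrink_count j)"
    unfolding final_scale_def by blast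
  then have "cube c (final_scale j) \<in> supertile j"
    unfolding supertile_def exp_inflation_time[symmetric]
    by (rule small_tile_in_flow) (simp add: measure_cube_le_1_iff final_scale_pos final_scale_le_1)
  then show ?thesis using supertile_mono[OF assms] by blast
qed

lemma translation_class_cube:
  fixes c :: "real ^ 'd"
  shows "translation_rel `` {cube c a} = range (\<lambda>v. cube v a)"
proof -
  have "affine_copy v 1 (cube c a) = cube (v + c) a" for v by (simp add: affine_copy_cube)
  moreover have "cube v a = cube ((v - c) + c) a" for v by simp
  ultimately show ?thesis unfolding translation_rel_def by blast
qed

lemma tile_complexity_cube_scheme:
  "tile_complexity cube_scheme inflation_time (cube 0 1 :: (real ^ 'd::finite) set) k = k + 1"
proof -
  let ?E = "\<lambda>x. range (\<lambda>v :: real ^ 'd. cube v x)"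
  have "supertile k // translation_rel = (?E \<circ> final_scale) ` {..k}"
  proof
    show "supertile k // translation_rel \<subseteq> (?E \<circ> final_scale) ` {..k}"
    proof
      fix X :: "(real ^ 'd) set set" assume "X \<in> supertile k // translation_rel"
      then obtain S where "S \<in> supertile k" "X = translation_rel `` {S}" by (auto elim: quotientE)
      moreover obtain c j where "j \<le> k" "S = cube c (final_scale j)"
        using supertile_scales_subset[of k] \<open>S \<in> supertile k\<close> unfolding cubes_with_scales_def by blast
      ultimately show "X \<in> (?E \<circ> final_scale) ` {..k}"
        by (auto simp: translation_class_cube)
    qed
    show "(?E \<circ> final_scale) ` {..k} \<subseteq> supertile k // translation_rel"
    proof
      fix X assume "X \<in> (?E \<circ> final_scale) ` {..k}"
      then obtain j where "j \<le> k" "X = ?E (final_scale j)" by auto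
      then show "X \<in> supertile k // translation_rel"
        using final_scale_in_supertile translation_class_cube quotientI by metis
    qed
  qed
  moreover have "inj (?E \<circ> final_scale)"
  proof (rule injI)
    fix i j assume "(?E \<circ> final_scale) i = (?E \<circ> final_scale) j"
    then have "cube 0 (final_scale i) \<in> ?E (final_scale j)" by auto
    then obtain v where "cube (0 :: real ^ 'd) (final_scale i) = cube v (final_scale j)" by blast
    then show "i = j" using inj_final_scale by (simp add: cube_eq_iff final_scale_pos inj_eq)
  qed
  then have "card ((?E \<circ> final_scale) ` {..k}) = k + 1"
    by (subst card_image) (auto intro: inj_on_subset)
  ultimately show ?thesis by (simp add: tile_complexity_def supertile_def)
qed

theorem proposition5p4:
  shows "\<exists>(\<sigma> :: 'd::finite scheme) s T \<S>.
     multiscale_scheme \<sigma> \<and> normalized \<sigma> \<and> geometrically_distinct \<sigma>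
     \<and> irreducible_scheme \<sigma> \<and> incommensurable \<sigma>
     \<and> stationary_tiling \<sigma> s \<S> \<and> presented_by \<sigma> s T \<S>
     \<and> (\<forall>k::nat. tile_complexity \<sigma> s T (k + 1) = tile_complexity \<sigma> s T k + 1)"
proof (intro exI conjI allI)
  show "normalized (cube_scheme :: 'd scheme)" "geometrically_distinct (cube_scheme :: 'd scheme)"
    by (simp_all add: normalized_def geometrically_distinct_def measure_cube)
  show "tile_complexity cube_scheme inflation_time (cube 0 1 :: (real ^ 'd) set) (k + 1)
      = tile_complexity cube_scheme inflation_time (cube 0 1 :: (real ^ 'd) set) k + 1" for k
    by (simp add: tile_complexity_cube_scheme)
qed (fact multiscale_cube_scheme irreducible_cube_scheme incommensurable_cube_scheme
    stationary_cube_tiling presented_cube_tiling)+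

end
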